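(* For all integers $k\geq 1$ and $n\geq 1$, the generalized Bernoulli numbers $B_n^{(m)}$ and the Bernoulli numbers $B_n$ satisfy $$B_{n}^{(k)}=\binom{k}{1}B_{n}+\sum_{i=1}^{n-1}\binom{n}{i}B_{i}\sum_{l=1}^{k-1}B_{n-i}^{(k-l)}$$ and $$B_{n}^{(-k)}=\binom{k}{1}\frac{1}{n+1}+\sum_{i=1}^{n-1}\frac{1}{i+1}\binom{n}{i}\sum_{l=1}^{k-1}B_{n-i}^{(-(k-l))}.$$
   Context: For any integer $m$, the generalized Bernoulli numbers $B_n^{(m)}$ are defined by the formal power series identity $\left(1+\sum_{n\geq 1}\frac{1}{(n+1)!}X^{n}\right)^{-m}=1+\sum_{n\geq 1}\frac{1}{n!}B_{n}^{(m)}X^{n}$, with $B_0^{(m)}=1$; the Bernoulli numbers are $B_n=B_n^{(1)}$. Empty sums are $0$. *)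

theory Defs
  imports Complex_Main "HOL-Computational_Algebra.Formal_Power_Series"
begin

text \<open>The formal power series $(e^X - 1)/X$ over the rationals; the coefficient
  at index 0 is $1/1! = 1$, so its negative integer powers are genuine inverses.\<close>

definition bernoulli_base :: "rat fps" where
  "bernoulli_base = Abs_fps (\<lambda>n. 1 / fact (n + 1))"

definition gen_bernoulli :: "int \<Rightarrow> nat \<Rightarrow> rat" where
  "gen_bernoulli m n = fact n * fps_nth (bernoulli_base powi (- m)) n"

definition bernoulli :: "nat \<Rightarrow> rat" where
  "bernoulli n = gen_bernoulli 1 n"

lemma bernoulli_base_nth_0: "fps_nth bernoulli_base 0 = 1"
  by (simp add: bernoulli_base_def)

lemma gen_bernoulli_0: "gen_bernoulli m 0 = 1"
  by (simp add: gen_bernoulli_def power_int_def bernoulli_base_nth_0 fps_power_zeroth)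

lemma gen_bernoulli_generating_function:
  "bernoulli_base powi (- m) = Abs_fps (\<lambda>n. gen_bernoulli m n / fact n)"
  by (rule fps_ext) (simp add: gen_bernoulli_def)

lemma bernoulli_base_powi_cancel:
  "bernoulli_base powi (- m) * bernoulli_base powi m = 1"
  by (simp add: power_int_def bernoulli_base_nth_0 inverse_mult_eq_1 inverse_mult_eq_1'
      flip: power_mult_distrib)

end

theory Submission
  imports Defs
begin

text \<open>
  Both identities are the same fact about a formal power series $f$ with constant term 1,
  applied once to $f = X/(e^X-1)$, whose powers generate the $B_n^{(k)}$, and once to its
  inverse $f = (e^X-1)/X$, whose powers generate the $B_n^{(-k)}$.  The fact is the
  geometric sum
  \[ f^k - 1 = (f - 1)\,(1 + f + \dots + f^{k-1}) \]
  read off at $X^n$.  Since $f - 1$ has no constant term, the Cauchy product on the right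
  starts at index $1$; its last term, where the coefficient of $f$ is taken at $n$, picks up
  the constant term $k$ of the geometric sum and gives the leading
  summand, which is $\binom{k}{1} B_n$ or $\binom{k}{1} \frac{1}{n+1}$.  In the remaining terms the power $f^0 = 1$ contributes nothing,
  so only $f^1, \dots, f^{k-1}$ are left.  Passing to exponential coefficients turns the
  products of factorials into binomial coefficients.
\<close>

unbundle fps_syntax

lemma fps_power_nth_geometric:
  fixes f :: "'a::comm_ring_1 fps"
  assumes f0: "f $ 0 = 1" and n: "n \<ge> 1"
  shows "(f ^ k) $ n = of_nat k * f $ n + (\<Sum>i=1..n-1. f $ i * (\<Sum>j=1..<k. (f ^ j) $ (n - i)))"
proof -
  define S where "S = (\<Sum>j<k. f ^ j)"
  have S0: "S $ 0 = of_nat k"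
    by (simp add: S_def fps_sum_nth fps_power_zeroth f0)
  have S_pos: "S $ m = (\<Sum>j=1..<k. (f ^ j) $ m)" if "m \<ge> 1" for m
    unfolding S_def fps_sum_nth
    by (rule sum.mono_neutral_right) (use that in \<open>auto simp: not_less_eq_eq\<close>)
  have "(f ^ k) $ n = (f ^ k - 1) $ n"
    using n by simp
  also have "\<dots> = ((f - 1) * S) $ n"
    by (simp add: S_def power_diff_1_eq)
  also have "\<dots> = (\<Sum>i=0..n. (f - 1) $ i * S $ (n - i))"
    by (simp add: fps_mult_nth)
  also have "\<dots> = (\<Sum>i=1..n. f $ i * S $ (n - i))"
    by (rule sum.mono_neutral_cong_right) (auto simp: f0 not_less_eq_eq)
  also have "{1..n} = insert n {1..n-1}"
    using n by auto
  also have "(\<Sum>i\<in>insert n {1..n-1}. f $ i * S $ (n - i)) =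
      of_nat k * f $ n + (\<Sum>i=1..n-1. f $ i * S $ (n - i))"
    using n by (subst sum.insert) (auto simp: S0 mult.commute)
  also have "(\<Sum>i=1..n-1. f $ i * S $ (n - i)) =
      (\<Sum>i=1..n-1. f $ i * (\<Sum>j=1..<k. (f ^ j) $ (n - i)))"
    by (rule sum.cong) (use n in \<open>auto simp: S_pos\<close>)
  finally show ?thesis .
qed

text \<open>
  Multiplying by $n!$ and using $n! = \binom{n}{i}\, i!\, (n-i)!$.  The powers of $f$
  are listed downwards, as $f^{k-l}$, which is the order in which the orders $k-l$ of the
  generalized Bernoulli numbers occur.
\<close>

lemma fps_power_fact_nth_recurrence:
  fixes f :: "'a::field_char_0 fps"
  assumes f0: "f $ 0 = 1" and n: "n \<ge> 1"
  shows "fact n * (f ^ k) $ n = of_nat k * (fact n * f $ n) +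
    (\<Sum>i=1..n-1. of_nat (n choose i) * (fact i * f $ i) *
       (\<Sum>l=1..k-1. fact (n - i) * (f ^ (k - l)) $ (n - i)))"
proof -
  have reflect: "(\<Sum>j=1..<k. (f ^ j) $ m) = (\<Sum>l=1..k-1. (f ^ (k - l)) $ m)" for m
    by (rule sum.reindex_bij_witness[of _ "\<lambda>l. k - l" "\<lambda>j. k - j"]) auto
  have absorb: "fact n * (f $ i * s) = of_nat (n choose i) * (fact i * f $ i) * (fact (n - i) * s)"
    if "i \<in> {1..n-1}" for i and s :: 'a
  proof -
    have "i \<le> n"
      using that by auto
    then have "fact n = of_nat (n choose i) * fact i * (fact (n - i) :: 'a)"
      using binomial_fact_lemma[of i n, THEN arg_cong[where f = "of_nat :: nat \<Rightarrow> 'a"]]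
      by (simp add: algebra_simps)
    then show ?thesis
      by (simp add: algebra_simps)
  qed
  have "fact n * (f ^ k) $ n = of_nat k * (fact n * f $ n) +
      (\<Sum>i=1..n-1. fact n * (f $ i * (\<Sum>l=1..k-1. (f ^ (k - l)) $ (n - i))))"
    unfolding fps_power_nth_geometric[OF f0 n, of k] reflect
    by (simp only: distrib_left mult.left_commute[of "fact n" "of_nat k"]
        sum_distrib_left[of "fact n"])
  then show ?thesis
    by (simp only: absorb sum_distrib_left[of "fact _"] cong: sum.cong)
qed

lemma gen_bernoulli_of_nat:
  "gen_bernoulli (int k) n = fact n * (inverse bernoulli_base ^ k) $ n"
  by (cases "k = 0") (simp_all add: gen_bernoulli_def power_int_def)

lemma gen_bernoulli_minus_of_nat:
  "gen_bernoulli (- int k) n = fact n * (bernoulli_base ^ k) $ n"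
  by (simp add: gen_bernoulli_def)

lemma fact_mult_bernoulli_base_nth: "fact n * bernoulli_base $ n = 1 / of_nat (n + 1)"
  by (simp add: bernoulli_base_def)

theorem theorem2p9:
  fixes k n :: nat
  assumes "k \<ge> 1" and "n \<ge> 1"
  shows "gen_bernoulli (int k) n =
           of_nat (k choose 1) * bernoulli n
           + (\<Sum>i=1..n-1. of_nat (n choose i) * bernoulli i
                * (\<Sum>l=1..k-1. gen_bernoulli (int k - int l) (n - i)))
       \<and> gen_bernoulli (- int k) n =
           of_nat (k choose 1) * (1 / of_nat (n + 1))
           + (\<Sum>i=1..n-1. 1 / of_nat (i + 1) * of_nat (n choose i)
                * (\<Sum>l=1..k-1. gen_bernoulli (- (int k - int l)) (n - i)))"
proof
  have order: "int k - int l = int (k - l)" if "l \<in> {1..k-1}" for l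
    using that by auto
  have bernoulli_eq: "bernoulli m = fact m * inverse bernoulli_base $ m" for m
    using gen_bernoulli_of_nat[of 1 m] by (simp add: bernoulli_def)
  have inverse0: "inverse bernoulli_base $ 0 = 1"
    by (simp add: bernoulli_base_nth_0)
  show "gen_bernoulli (int k) n =
      of_nat (k choose 1) * bernoulli n
      + (\<Sum>i=1..n-1. of_nat (n choose i) * bernoulli i
           * (\<Sum>l=1..k-1. gen_bernoulli (int k - int l) (n - i)))"
    using fps_power_fact_nth_recurrence[OF inverse0 \<open>n \<ge> 1\<close>, of k]
    by (simp only: order gen_bernoulli_of_nat bernoulli_eq choose_one cong: sum.cong)
  show "gen_bernoulli (- int k) n =
      of_nat (k choose 1) * (1 / of_nat (n + 1))
      + (\<Sum>i=1..n-1. 1 / of_nat (i + 1) * of_nat (n choose i)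
           * (\<Sum>l=1..k-1. gen_bernoulli (- (int k - int l)) (n - i)))"
    using fps_power_fact_nth_recurrence[OF bernoulli_base_nth_0 \<open>n \<ge> 1\<close>, of k]
    by (simp only: order gen_bernoulli_minus_of_nat fact_mult_bernoulli_base_nth choose_one
        mult.commute[of "1 / of_nat _" "of_nat _"] cong: sum.cong)
qed

end
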